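(* Let $G=(V,E)$ be a connected locally finite graph with symmetric positive edge weights $w_{xy}=w_{yx}>0$ ($xy\in E$) and positive measure $\mu:V\to(0,+\infty)$, let $O\in V$ be a fixed vertex, let $m>0$ and $p>2$, and let $h:V\to\mathbb{R}$. Assume: (c1) there is a constant $\mu_{\min}>0$ such that $\mu(x)\ge\mu_{\min}$ for all $x\in V$; (c2) $\inf_{x\in V}h(x)=h_0>0$ and $h(x)\to+\infty$ as $\rho(x)\to\infty$, where $\rho(x)=d(x,O)$; (c3) $$h(O)<m\left\{\frac{2}{p}\,\frac{\mu(O)^{2-\frac p2}}{\deg(O)}\right\}^{\frac{2}{p-2}}.$$ Then there exist $\lambda_m\in\mathbb{R}$ and $u_m\in\mathcal{H}$ such that $$-\Delta u_m(x)+\lambda_m h(x)u_m(x)=u_m(x)^{p-1}\quad\text{and}\quad u_m(x)>0\quad\text{for all }x\in V,\qquad \int_V h u_m^2\,d\mu=m.$$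
   Context: A graph is locally finite if every $x\in V$ has only finitely many $y\in V$ with $xy\in E$. $y\sim x$ means $xy\in E$; $\deg(x)=\sum_{y\sim x}w_{xy}$; $d(x,O)$ is the graph distance. For $u:V\to\mathbb{R}$, $\Delta u(x)=\frac{1}{\mu(x)}\sum_{y\sim x}w_{xy}(u(y)-u(x))$, $|\nabla u|^2(x)=\frac{1}{2\mu(x)}\sum_{y\sim x}w_{xy}(u(y)-u(x))^2$, and $\int_V u\,d\mu=\sum_{x\in V}\mu(x)u(x)$. $C_c(V)$ is the set of functions $V\to\mathbb{R}$ with finite support; $H_0(V)$ is the completion of $C_c(V)$ under the norm $\|u\|_{H_0}=\left(\int_V(|\nabla u|^2+u^2)\,d\mu\right)^{1/2}$ (regarded as a space of functions on $V$); and $\mathcal{H}=\{u\in H_0(V):\int_V(|\nabla u|^2+hu^2)\,d\mu<+\infty\}$. The real number $\lambda_m$ is not prescribed; it is part of the unknown (a Lagrange multiplier). *)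

theory Defs
  imports "HOL-Analysis.Analysis"
begin

text \<open>
  The vertex set \<open>V\<close> is the type \<open>'a\<close>. A graph is given by its adjacency relation \<open>E\<close>, a symmetric set
  of ordered pairs. Weights \<open>w\<close> and measure \<open>\<mu>\<close> are total functions, but \<open>w x y\<close> is only ever used
  for \<open>(x, y) \<in> E\<close>.
\<close>

definition locally_finite_graph :: "('a \<times> 'a) set \<Rightarrow> bool" where
  "locally_finite_graph E \<longleftrightarrow> (\<forall>x. finite (E `` {x}))"

definition connected_graph :: "('a \<times> 'a) set \<Rightarrow> bool" where
  "connected_graph E \<longleftrightarrow> (\<forall>x y. (x, y) \<in> E\<^sup>*)"

text \<open>Meaningful when some walk joins the two vertices, as is always the case in a connected graph.\<close>

definition graph_dist :: "('a \<times> 'a) set \<Rightarrow> 'a \<Rightarrow> 'a \<Rightarrow> nat" where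
  "graph_dist E x y = (LEAST n. (x, y) \<in> E ^^ n)"

definition wdeg :: "('a \<times> 'a) set \<Rightarrow> ('a \<Rightarrow> 'a \<Rightarrow> real) \<Rightarrow> 'a \<Rightarrow> real" where
  "wdeg E w x = (\<Sum>y\<in>E `` {x}. w x y)"

definition laplacian ::
  "('a \<times> 'a) set \<Rightarrow> ('a \<Rightarrow> 'a \<Rightarrow> real) \<Rightarrow> ('a \<Rightarrow> real) \<Rightarrow> ('a \<Rightarrow> real) \<Rightarrow> 'a \<Rightarrow> real" where
  "laplacian E w \<mu> u x = 1 / \<mu> x * (\<Sum>y\<in>E `` {x}. w x y * (u y - u x))"

text \<open>The squared length \<open>|\<nabla>u|\<^sup>2(x)\<close>, not the gradient itself.\<close>

definition grad_sq ::
  "('a \<times> 'a) set \<Rightarrow> ('a \<Rightarrow> 'a \<Rightarrow> real) \<Rightarrow> ('a \<Rightarrow> real) \<Rightarrow> ('a \<Rightarrow> real) \<Rightarrow> 'a \<Rightarrow> real" where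
  "grad_sq E w \<mu> u x = 1 / (2 * \<mu> x) * (\<Sum>y\<in>E `` {x}. w x y * (u y - u x)\<^sup>2)"

text \<open>
  The integral \<open>\<integral>\<^sub>V f d\<mu>\<close> is an unordered sum over the vertices. Finiteness is a separate predicate
  because \<^const>\<open>infsum\<close> returns 0 on functions that are not summable.
\<close>

definition vintegrable :: "('a \<Rightarrow> real) \<Rightarrow> ('a \<Rightarrow> real) \<Rightarrow> bool" where
  "vintegrable \<mu> f \<longleftrightarrow> (\<lambda>x. \<mu> x * f x) summable_on UNIV"

definition vintegral :: "('a \<Rightarrow> real) \<Rightarrow> ('a \<Rightarrow> real) \<Rightarrow> real" where
  "vintegral \<mu> f = (\<Sum>\<^sub>\<infinity>x. \<mu> x * f x)"

definition C_c :: "('a \<Rightarrow> real) set" where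
  "C_c = {u. finite {x. u x \<noteq> 0}}"

definition H0_norm ::
  "('a \<times> 'a) set \<Rightarrow> ('a \<Rightarrow> 'a \<Rightarrow> real) \<Rightarrow> ('a \<Rightarrow> real) \<Rightarrow> ('a \<Rightarrow> real) \<Rightarrow> real" where
  "H0_norm E w \<mu> u = sqrt (vintegral \<mu> (\<lambda>x. grad_sq E w \<mu> u x + (u x)\<^sup>2))"

text \<open>
  The completion of \<^const>\<open>C_c\<close> under \<^const>\<open>H0_norm\<close>, realised as a space of functions: an element of the
  completion is a class of Cauchy sequences in \<^const>\<open>C_c\<close>, and since \<open>\<mu> x * (u x)\<^sup>2 \<le> (H0_norm E w \<mu> u)\<^sup>2\<close>
  such a sequence converges at every vertex, to a limit depending only on the class. Distinct
  classes have distinct limits by Fatou's lemma, so nothing is identified. On a locally finite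
  graph \<^const>\<open>H0_norm\<close> is only applied to finitely supported functions here, for which the sum in
  its definition is finite.
\<close>

definition H0_space ::
  "('a \<times> 'a) set \<Rightarrow> ('a \<Rightarrow> 'a \<Rightarrow> real) \<Rightarrow> ('a \<Rightarrow> real) \<Rightarrow> ('a \<Rightarrow> real) set" where
  "H0_space E w \<mu> = {u. \<exists>\<phi> :: nat \<Rightarrow> 'a \<Rightarrow> real.
      (\<forall>n. \<phi> n \<in> C_c) \<and>
      (\<forall>\<epsilon>>0. \<exists>N. \<forall>m\<ge>N. \<forall>n\<ge>N. H0_norm E w \<mu> (\<lambda>x. \<phi> m x - \<phi> n x) < \<epsilon>) \<and>
      (\<forall>x. (\<lambda>n. \<phi> n x) \<longlonglongrightarrow> u x)}"

definition H_space ::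
  "('a \<times> 'a) set \<Rightarrow> ('a \<Rightarrow> 'a \<Rightarrow> real) \<Rightarrow> ('a \<Rightarrow> real) \<Rightarrow> ('a \<Rightarrow> real) \<Rightarrow> ('a \<Rightarrow> real) set" where
  "H_space E w \<mu> h =
     {u \<in> H0_space E w \<mu>. vintegrable \<mu> (\<lambda>x. grad_sq E w \<mu> u x + h x * (u x)\<^sup>2)}"

end

theory Submission
  imports Defs
begin

text \<open>
  Minimise the energy \<open>\<integral> \<bar>\<nabla>u\<bar>\<^sup>2 / 2 - \<integral> \<bar>u\<bar>\<^sup>p / p\<close> under the constraint \<open>\<integral> h u\<^sup>2 \<le> m\<close>. Because \<open>h\<close> is
  bounded below by a positive constant and \<open>\<mu>\<close> is too, the constraint bounds \<open>u\<close> uniformly; because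
  \<open>h\<close> tends to infinity, it also makes the tails of \<open>\<integral> \<bar>u\<bar>\<^sup>p\<close> uniformly small. So this term behaves
  continuously under pointwise convergence, while the Dirichlet energy and the mass \<open>\<integral> h u\<^sup>2\<close>, sums of
  nonnegative terms, can only drop. The admissible functions lie in a product of compact intervals,
  hence a minimiser exists (\<open>minimizer_exists\<close>), and it can be taken nonnegative (\<open>minimizer_abs\<close>).

  In the limit some of the mass could be lost. This is where the hypothesis on \<open>h\<close> at the
  distinguished vertex is needed: a multiple of the indicator of that vertex has mass \<open>m\<close> and negative
  energy (\<open>spike_negative\<close>), so the minimum is negative. A minimiser with negative energy uses up
  the whole mass, since scaling it up would lower the energy further (\<open>negative_minimizer_saturates\<close>).

  Varying the minimiser at one vertex and rescaling to the same mass gives the equation, with the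
  multiplier \<open>(\<integral> u\<^sup>p - \<integral> \<bar>\<nabla>u\<bar>\<^sup>2) / m\<close> (\<open>Euler_Lagrange\<close>). At a zero of \<open>u\<close> the equation reduces to
  \<open>\<Delta>u = 0\<close>, so the zero would spread to all neighbours and, the graph being connected, to all of \<open>V\<close>
  (\<open>positive_if_harmonic_at_zeros\<close>). Finally, membership in the completion of the finitely supported
  functions is not automatic for a function of finite energy; it holds because \<open>\<mu>\<close> is bounded below
  (\<open>H0_space_if_finite_energy\<close>).
\<close>

section \<open>Integrals over the vertices\<close>

lemma sum_le_vintegral:
  assumes "vintegrable \<mu> f" "\<And>x. 0 \<le> \<mu> x * f x" "finite F"
  shows "(\<Sum>x\<in>F. \<mu> x * f x) \<le> vintegral \<mu> f"
  using assms unfolding vintegrable_def vintegral_def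
  by (intro finite_sum_le_infsum) auto

lemma
  assumes "\<And>x. 0 \<le> \<mu> x * f x" "\<And>F. finite F \<Longrightarrow> (\<Sum>x\<in>F. \<mu> x * f x) \<le> C"
  shows vintegrable_if_sums_bounded: "vintegrable \<mu> f"
    and vintegral_le_if_sums_bounded: "vintegral \<mu> f \<le> C"
proof -
  show "vintegrable \<mu> f"
    unfolding vintegrable_def
    using assms by (intro nonneg_bdd_above_summable_on bdd_aboveI[of _ C]) auto
  then show "vintegral \<mu> f \<le> C"
    unfolding vintegrable_def vintegral_def
    using assms by (intro infsum_le_finite_sums) auto
qed

lemma
  assumes "vintegrable \<mu> g" "\<And>x. 0 < \<mu> x" "\<And>x. 0 \<le> f x" "\<And>x. f x \<le> g x"
  shows vintegrable_dominated: "vintegrable \<mu> f"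
    and vintegral_mono: "vintegral \<mu> f \<le> vintegral \<mu> g"
proof -
  have le: "\<mu> x * f x \<le> \<mu> x * g x" for x
    using assms by (simp add: mult_left_mono)
  show "vintegrable \<mu> f"
    using assms(1) unfolding vintegrable_def
    by (rule summable_on_comparison_test) (use assms le in \<open>auto simp: less_imp_le\<close>)
  then show "vintegral \<mu> f \<le> vintegral \<mu> g"
    using assms(1) le unfolding vintegrable_def vintegral_def by (intro infsum_mono) auto
qed

lemma vintegrable_add:
  "vintegrable \<mu> f \<Longrightarrow> vintegrable \<mu> g \<Longrightarrow> vintegrable \<mu> (\<lambda>x. f x + g x)"
  unfolding vintegrable_def by (simp add: distrib_left summable_on_add)

lemma vintegral_eq_0:
  assumes "\<And>x. f x = 0"
  shows "vintegrable \<mu> f" "vintegral \<mu> f = 0"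
  using assms unfolding vintegrable_def vintegral_def by simp_all

lemma vintegrable_cmult: "vintegrable \<mu> f \<Longrightarrow> vintegrable \<mu> (\<lambda>x. c * f x)"
  unfolding vintegrable_def by (simp add: mult.left_commute summable_on_cmult_right)

lemma vintegral_cmult: "vintegral \<mu> (\<lambda>x. c * f x) = c * vintegral \<mu> f"
  unfolding vintegral_def by (simp add: mult.left_commute infsum_cmult_right')

text \<open>
  All test functions below differ from a given function at one vertex, which changes the integrands
  at finitely many vertices only. The change of the integral is then a finite sum, so that first
  variations need no interchange of limits and infinite sums.
\<close>

lemma
  assumes "vintegrable \<mu> f" "finite A" "\<And>x. x \<notin> A \<Longrightarrow> g x = f x"
  shows vintegrable_modify_finite: "vintegrable \<mu> g"
    and vintegral_modify_finite: "vintegral \<mu> g = vintegral \<mu> f + (\<Sum>x\<in>A. \<mu> x * g x - \<mu> x * f x)"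
proof -
  have "((\<lambda>x. \<mu> x * g x - \<mu> x * f x) has_sum (\<Sum>x\<in>A. \<mu> x * g x - \<mu> x * f x)) UNIV"
    using assms by (intro has_sum_finite_neutralI[of A]) auto
  moreover have "((\<lambda>x. \<mu> x * f x) has_sum vintegral \<mu> f) UNIV"
    using assms(1) by (simp add: vintegrable_def vintegral_def)
  ultimately have "((\<lambda>x. \<mu> x * f x + (\<mu> x * g x - \<mu> x * f x)) has_sum
      (vintegral \<mu> f + (\<Sum>x\<in>A. \<mu> x * g x - \<mu> x * f x))) UNIV"
    by (intro has_sum_add)
  then have "((\<lambda>x. \<mu> x * g x) has_sum (vintegral \<mu> f + (\<Sum>x\<in>A. \<mu> x * g x - \<mu> x * f x))) UNIV"
    by simp
  then show "vintegrable \<mu> g"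
    and "vintegral \<mu> g = vintegral \<mu> f + (\<Sum>x\<in>A. \<mu> x * g x - \<mu> x * f x)"
    unfolding vintegrable_def vintegral_def by (auto dest: has_sum_imp_summable infsumI)
qed

lemma vintegral_small_tail:
  assumes "vintegrable \<mu> f" "\<And>x. 0 \<le> \<mu> x * f x" "0 < \<delta>"
  obtains F where "finite F"
    "\<And>A. finite A \<Longrightarrow> A \<inter> F = {} \<Longrightarrow> (\<Sum>x\<in>A. \<mu> x * f x) < \<delta>"
proof -
  have "((\<lambda>F. \<Sum>x\<in>F. \<mu> x * f x) \<longlongrightarrow> vintegral \<mu> f) (finite_subsets_at_top UNIV)"
    using assms(1) has_sum_infsum unfolding vintegrable_def vintegral_def has_sum_def by blast
  then have "\<forall>\<^sub>F F in finite_subsets_at_top UNIV. vintegral \<mu> f - \<delta> < (\<Sum>x\<in>F. \<mu> x * f x)"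
    using assms(3) by (intro order_tendstoD) auto
  then obtain F where F: "finite F" "vintegral \<mu> f - \<delta> < (\<Sum>x\<in>F. \<mu> x * f x)"
    unfolding eventually_finite_subsets_at_top by auto
  show thesis
  proof (rule that[OF F(1)])
    fix A assume A: "finite A" "A \<inter> F = {}"
    have "(\<Sum>x\<in>A. \<mu> x * f x) + (\<Sum>x\<in>F. \<mu> x * f x) = (\<Sum>x\<in>A \<union> F. \<mu> x * f x)"
      using A F(1) by (simp add: sum.union_disjoint)
    also have "\<dots> \<le> vintegral \<mu> f"
      using assms A F(1) by (intro sum_le_vintegral) auto
    finally show "(\<Sum>x\<in>A. \<mu> x * f x) < \<delta>"
      using F(2) by simp
  qed
qed

section \<open>The Dirichlet energy\<close>

locale weighted_graph =
  fixes E :: "('a \<times> 'a) set"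
    and w :: "'a \<Rightarrow> 'a \<Rightarrow> real"
    and \<mu> :: "'a \<Rightarrow> real"
  assumes sym_E: "sym E"
    and locally_finite: "locally_finite_graph E"
    and weight_sym: "(x, y) \<in> E \<Longrightarrow> w x y = w y x"
    and weight_pos: "(x, y) \<in> E \<Longrightarrow> 0 < w x y"
    and measure_pos: "0 < \<mu> x"
begin

abbreviation nbrs :: "'a \<Rightarrow> 'a set" where
  "nbrs x \<equiv> E `` {x}"

abbreviation dirichlet :: "('a \<Rightarrow> real) \<Rightarrow> real" where
  "dirichlet u \<equiv> vintegral \<mu> (grad_sq E w \<mu> u)"

abbreviation finite_dirichlet :: "('a \<Rightarrow> real) \<Rightarrow> bool" where
  "finite_dirichlet u \<equiv> vintegrable \<mu> (grad_sq E w \<mu> u)"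

lemma finite_nbrs: "finite (nbrs x)"
  using locally_finite by (simp add: locally_finite_graph_def)

lemma nbrs_sym: "y \<in> nbrs x \<longleftrightarrow> x \<in> nbrs y"
  using sym_E by (auto dest: symD)

lemma measure_grad_sq:
  "\<mu> x * grad_sq E w \<mu> u x = (\<Sum>y\<in>nbrs x. w x y * (u y - u x)\<^sup>2) / 2"
  using measure_pos[of x] by (simp add: grad_sq_def)

lemma grad_sq_mono:
  assumes "\<And>y. y \<in> nbrs x \<Longrightarrow> \<bar>u y - u x\<bar> \<le> \<bar>v y - v x\<bar>"
  shows "grad_sq E w \<mu> u x \<le> grad_sq E w \<mu> v x"
proof -
  have "(\<Sum>y\<in>nbrs x. w x y * (u y - u x)\<^sup>2) \<le> (\<Sum>y\<in>nbrs x. w x y * (v y - v x)\<^sup>2)"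
    using assms weight_pos
    by (intro sum_mono mult_left_mono) (auto simp: abs_le_square_iff less_imp_le)
  then show ?thesis
    using measure_pos[of x] by (simp add: grad_sq_def divide_right_mono)
qed

lemma grad_sq_nonneg: "0 \<le> grad_sq E w \<mu> u x"
  using grad_sq_mono[of x "\<lambda>_. 0" u] by (simp add: grad_sq_def)

lemma measure_grad_sq_nonneg: "0 \<le> \<mu> x * grad_sq E w \<mu> u x"
  using grad_sq_nonneg measure_pos by (simp add: less_imp_le)

lemma dirichlet_nonneg: "0 \<le> dirichlet u"
  unfolding vintegral_def by (intro infsum_nonneg) (simp add: measure_grad_sq_nonneg)

lemma grad_sq_scale: "grad_sq E w \<mu> (\<lambda>x. c * u x) = (\<lambda>x. c\<^sup>2 * grad_sq E w \<mu> u x)"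
proof
  fix x
  have "(\<Sum>y\<in>nbrs x. w x y * (c * u y - c * u x)\<^sup>2) = (\<Sum>y\<in>nbrs x. c\<^sup>2 * (w x y * (u y - u x)\<^sup>2))"
    by (intro sum.cong refl) algebra
  then show "grad_sq E w \<mu> (\<lambda>x. c * u x) x = c\<^sup>2 * grad_sq E w \<mu> u x"
    by (simp add: grad_sq_def sum_distrib_left[symmetric])
qed

text \<open>
  Every edge joining \<open>z\<close> to another vertex is seen from both of its ends, each time with weight one
  half; a loop at \<open>z\<close> contributes nothing. Hence the sum over the neighbours other than \<open>z\<close>, without
  the factor one half of the definition.
\<close>

lemma
  assumes "finite_dirichlet u"
  shows finite_dirichlet_fun_upd: "finite_dirichlet (u(z := s))"
    and dirichlet_fun_upd: "dirichlet (u(z := s)) =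
      dirichlet u + (\<Sum>y\<in>nbrs z - {z}. w z y * ((u y - s)\<^sup>2 - (u y - u z)\<^sup>2))"
proof -
  let ?v = "u(z := s)"
  let ?c = "\<lambda>y. w z y * ((u y - s)\<^sup>2 - (u y - u z)\<^sup>2) / 2"
  let ?A = "insert z (nbrs z)"
  have far: "grad_sq E w \<mu> ?v x = grad_sq E w \<mu> u x" if "x \<notin> ?A" for x
  proof -
    have "z \<notin> nbrs x" "x \<noteq> z"
      using that nbrs_sym[of z x] by auto
    then have "(\<Sum>y\<in>nbrs x. w x y * (?v y - ?v x)\<^sup>2) = (\<Sum>y\<in>nbrs x. w x y * (u y - u x)\<^sup>2)"
      by (intro sum.cong) auto
    then show ?thesis
      by (simp add: grad_sq_def)
  qed
  have at: "\<mu> z * grad_sq E w \<mu> ?v z - \<mu> z * grad_sq E w \<mu> u z = (\<Sum>y\<in>nbrs z - {z}. ?c y)"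
  proof -
    have "\<mu> z * grad_sq E w \<mu> ?v z - \<mu> z * grad_sq E w \<mu> u z
      = (\<Sum>y\<in>nbrs z. w z y * ((?v y - ?v z)\<^sup>2 - (u y - u z)\<^sup>2) / 2)"
      by (simp add: measure_grad_sq sum_subtractf sum_divide_distrib algebra_simps diff_divide_distrib)
    also have "\<dots> = (\<Sum>y\<in>nbrs z - {z}. ?c y)"
      using finite_nbrs by (intro sum.mono_neutral_cong_right) auto
    finally show ?thesis .
  qed
  have near: "\<mu> x * grad_sq E w \<mu> ?v x - \<mu> x * grad_sq E w \<mu> u x = ?c x"
    if "x \<in> nbrs z - {z}" for x
  proof -
    have x: "z \<in> nbrs x" "x \<noteq> z" "w x z = w z x"
      using that nbrs_sym[of z x] weight_sym by auto
    have "\<mu> x * grad_sq E w \<mu> ?v x - \<mu> x * grad_sq E w \<mu> u x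
      = (\<Sum>y\<in>nbrs x. w x y * ((?v y - ?v x)\<^sup>2 - (u y - u x)\<^sup>2) / 2)"
      by (simp add: measure_grad_sq sum_subtractf sum_divide_distrib algebra_simps diff_divide_distrib)
    also have "\<dots> = (\<Sum>y\<in>{z}. w x y * ((?v y - ?v x)\<^sup>2 - (u y - u x)\<^sup>2) / 2)"
      using finite_nbrs x by (intro sum.mono_neutral_right) auto
    also have "\<dots> = ?c x"
      using x by (simp add: power2_commute)
    finally show ?thesis .
  qed
  have fin: "finite ?A"
    using finite_nbrs by simp
  show "finite_dirichlet ?v"
    using assms fin far by (rule vintegrable_modify_finite)
  have "dirichlet ?v = dirichlet u
      + (\<Sum>x\<in>?A. \<mu> x * grad_sq E w \<mu> ?v x - \<mu> x * grad_sq E w \<mu> u x)"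
    using assms fin far by (rule vintegral_modify_finite)
  also have "(\<Sum>x\<in>?A. \<mu> x * grad_sq E w \<mu> ?v x - \<mu> x * grad_sq E w \<mu> u x)
      = (\<Sum>x\<in>insert z (nbrs z - {z}). \<mu> x * grad_sq E w \<mu> ?v x - \<mu> x * grad_sq E w \<mu> u x)"
    by simp
  also have "\<dots> = (\<mu> z * grad_sq E w \<mu> ?v z - \<mu> z * grad_sq E w \<mu> u z)
      + (\<Sum>x\<in>nbrs z - {z}. \<mu> x * grad_sq E w \<mu> ?v x - \<mu> x * grad_sq E w \<mu> u x)"
    using finite_nbrs by (intro sum.insert) auto
  also have "\<dots> = (\<Sum>y\<in>nbrs z - {z}. ?c y) + (\<Sum>y\<in>nbrs z - {z}. ?c y)"
    by (simp only: at sum.cong[OF refl near])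
  also have "\<dots> = (\<Sum>y\<in>nbrs z - {z}. w z y * ((u y - s)\<^sup>2 - (u y - u z)\<^sup>2))"
    by (simp add: sum.distrib[symmetric])
  finally show "dirichlet ?v =
      dirichlet u + (\<Sum>y\<in>nbrs z - {z}. w z y * ((u y - s)\<^sup>2 - (u y - u z)\<^sup>2))" .
qed

section \<open>Functions of finite energy lie in the completion\<close>

text \<open>
  For the approximants, move every value of \<open>u\<close> towards \<open>0\<close> by \<open>1/(n+1)\<close> (soft thresholding). Since
  \<open>\<mu>\<close> is bounded below, a function with integrable square exceeds any positive threshold at finitely
  many vertices only, so the results have finite support. The difference of two of them is a
  contraction of \<open>u\<close> (its increments are dominated by those of \<open>u\<close>) and is uniformly small: the
  first fact controls its norm off a finite set, the second one on that set.
\<close>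

lemma H0_space_if_finite_energy:
  assumes mu: "0 < \<mu>_min" "\<And>x. \<mu>_min \<le> \<mu> x"
    and D: "finite_dirichlet u" and L2: "vintegrable \<mu> (\<lambda>x. (u x)\<^sup>2)"
  shows "u \<in> H0_space E w \<mu>"
proof -
  define clamp where "clamp a s = max (- a) (min a s)" for a s :: real
  define b where "b n = 1 / real (Suc n)" for n
  define \<phi> where "\<phi> n x = u x - clamp (b n) (u x)" for n x
  define f where "f x = grad_sq E w \<mu> u x + (u x)\<^sup>2" for x
  have b_pos: "0 < b n" and b_le_1: "b n \<le> 1" and b_mono: "k \<le> n \<Longrightarrow> b n \<le> b k" for k n
    by (auto simp: b_def field_simps)
  have small: "\<bar>clamp a' s - clamp a s\<bar> \<le> c" if "0 \<le> a" "a \<le> c" "0 \<le> a'" "a' \<le> c" for a a' c s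
    using that unfolding clamp_def by linarith
  have contr: "\<bar>(clamp a' s - clamp a s) - (clamp a' t - clamp a t)\<bar> \<le> \<bar>s - t\<bar>"
    if "0 \<le> a" "0 \<le> a'" for a a' s t
    using that unfolding clamp_def by (smt (verit))
  have clamp_0: "clamp a 0 = 0" if "0 \<le> a" for a
    using that by (simp add: clamp_def)

  have "\<phi> n \<in> C_c" for n
  proof -
    have "0 < \<mu>_min * (b n)\<^sup>2"
      using mu(1) b_pos[of n] by simp
    then obtain F where F: "finite F"
      "\<And>A. finite A \<Longrightarrow> A \<inter> F = {} \<Longrightarrow> (\<Sum>x\<in>A. \<mu> x * (u x)\<^sup>2) < \<mu>_min * (b n)\<^sup>2"
      using vintegral_small_tail[OF L2] measure_pos by (metis less_imp_le mult_nonneg_nonneg zero_le_power2)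
    have "\<phi> n x = 0" if "x \<notin> F" for x
    proof -
      have "\<mu>_min * (u x)\<^sup>2 \<le> \<mu> x * (u x)\<^sup>2"
        using mu(2) by (simp add: mult_right_mono)
      also have "\<dots> < \<mu>_min * (b n)\<^sup>2"
        using F(2)[of "{x}"] that by simp
      finally have "(u x)\<^sup>2 < (b n)\<^sup>2"
        using mu(1) by simp
      then have "\<bar>u x\<bar> < b n"
        using b_pos[of n] by (metis less_imp_le power2_abs power2_less_imp_less)
      then show ?thesis
        by (auto simp: \<phi>_def clamp_def)
    qed
    then have "{x. \<phi> n x \<noteq> 0} \<subseteq> F"
      by auto
    then show ?thesis
      using F(1) by (auto simp: C_c_def intro: finite_subset)
  qed
  moreover have "(\<lambda>n. \<phi> n x) \<longlonglongrightarrow> u x" for x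
  proof -
    have b_lim: "b \<longlonglongrightarrow> 0"
      unfolding b_def using LIMSEQ_inverse_real_of_nat by (simp add: inverse_eq_divide)
    have "(\<lambda>n. \<phi> n x - u x) \<longlonglongrightarrow> 0"
    proof (rule Lim_null_comparison[OF _ b_lim])
      have "norm (\<phi> n x - u x) \<le> b n" for n
        using b_pos[of n] unfolding \<phi>_def clamp_def real_norm_def by linarith
      then show "\<forall>\<^sub>F n in sequentially. norm (\<phi> n x - u x) \<le> b n"
        by simp
    qed
    then show ?thesis
      by (rule LIM_zero_cancel)
  qed
  moreover have "\<exists>N. \<forall>n\<ge>N. \<forall>k\<ge>N. H0_norm E w \<mu> (\<lambda>x. \<phi> n x - \<phi> k x) < \<epsilon>" if "0 < \<epsilon>" for \<epsilon>
  proof -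
    have f: "vintegrable \<mu> f" and f_nonneg: "0 \<le> f x" for x
      unfolding f_def using D L2 grad_sq_nonneg by (auto intro: vintegrable_add)
    have "0 < \<epsilon>\<^sup>2 / 4"
      using that by simp
    then obtain F where F: "finite F"
      "\<And>A. finite A \<Longrightarrow> A \<inter> F = {} \<Longrightarrow> (\<Sum>x\<in>A. \<mu> x * f x) < \<epsilon>\<^sup>2 / 4"
      using vintegral_small_tail[OF f] measure_pos f_nonneg by (metis less_imp_le mult_nonneg_nonneg)
    \<comment> \<open>On \<open>F\<close>, the increments of a difference of approximants are at most \<open>2 * b N\<close> and \<open>(b N)\<^sup>2 \<le> b N\<close>, so the integrand is at most \<open>b N * c x\<close>.\<close>
    define c where "c x = 2 * wdeg E w x + \<mu> x" for x
    have c_nonneg: "0 \<le> c x" for x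
      unfolding c_def wdeg_def using weight_pos
      by (intro add_nonneg_nonneg mult_nonneg_nonneg sum_nonneg)
        (auto simp: less_imp_le measure_pos)
    then have "0 < \<epsilon>\<^sup>2 / 4 / (1 + sum c F)"
      using that by (intro divide_pos_pos) (auto intro!: add_pos_nonneg sum_nonneg)
    then obtain N where "b N < \<epsilon>\<^sup>2 / 4 / (1 + sum c F)"
      unfolding b_def using nat_approx_posE by blast
    then have "b N * (1 + sum c F) < \<epsilon>\<^sup>2 / 4"
      using c_nonneg by (subst (asm) pos_less_divide_eq) (auto intro!: add_pos_nonneg sum_nonneg)
    moreover have "b N * sum c F \<le> b N * (1 + sum c F)"
      using b_pos[of N] by (simp add: distrib_left)
    ultimately have N: "b N * sum c F < \<epsilon>\<^sup>2 / 4"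
      by simp
    have "H0_norm E w \<mu> (\<lambda>x. \<phi> n x - \<phi> k x) < \<epsilon>" if nk: "N \<le> n" "N \<le> k" for n k
    proof -
      define \<psi> where "\<psi> x = \<phi> n x - \<phi> k x" for x
      have \<psi>: "\<psi> x = clamp (b k) (u x) - clamp (b n) (u x)" for x
        by (simp add: \<psi>_def \<phi>_def)
      have bs: "0 \<le> b n" "0 \<le> b k" "b n \<le> b N" "b k \<le> b N"
        using b_pos b_mono nk by (auto simp: less_imp_le)
      have \<psi>_small: "\<bar>\<psi> x\<bar> \<le> b N" for x
        unfolding \<psi> using bs by (intro small)
      have \<psi>_contr: "\<bar>\<psi> y - \<psi> x\<bar> \<le> \<bar>u y - u x\<bar>" for x y
        unfolding \<psi> using bs by (intro contr)
      have "\<bar>\<psi> x\<bar> \<le> \<bar>u x\<bar>" for x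
        using contr[of "b n" "b k" "u x" 0] bs by (simp add: \<psi> clamp_0)
      then have le_f: "grad_sq E w \<mu> \<psi> x + (\<psi> x)\<^sup>2 \<le> f x" for x
        unfolding f_def using \<psi>_contr by (intro add_mono grad_sq_mono) (auto simp: abs_le_square_iff)
      have le_c: "\<mu> x * (grad_sq E w \<mu> \<psi> x + (\<psi> x)\<^sup>2) \<le> b N * c x" for x
      proof -
        have "(\<psi> y - \<psi> x)\<^sup>2 \<le> (2 * b N)\<^sup>2" for y
          using \<psi>_small[of x] \<psi>_small[of y] by (intro power2_le_iff_abs_le[THEN iffD2]) auto
        then have "(\<Sum>y\<in>nbrs x. w x y * (\<psi> y - \<psi> x)\<^sup>2) \<le> (\<Sum>y\<in>nbrs x. w x y * (2 * b N)\<^sup>2)"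
          using weight_pos by (intro sum_mono mult_left_mono) (auto simp: less_imp_le)
        then have "\<mu> x * grad_sq E w \<mu> \<psi> x \<le> (b N)\<^sup>2 * (2 * wdeg E w x)"
          by (simp add: measure_grad_sq wdeg_def sum_distrib_left sum_distrib_right power_mult_distrib algebra_simps)
        moreover have "\<mu> x * (\<psi> x)\<^sup>2 \<le> (b N)\<^sup>2 * \<mu> x"
          using \<psi>_small[of x] b_pos[of N] measure_pos[of x]
          by (subst mult.commute, intro mult_right_mono) (auto simp: power2_le_iff_abs_le less_imp_le)
        ultimately have "\<mu> x * (grad_sq E w \<mu> \<psi> x + (\<psi> x)\<^sup>2) \<le> (b N)\<^sup>2 * c x"
          by (simp add: c_def algebra_simps)
        also have "(b N)\<^sup>2 \<le> b N"
          using b_pos[of N] b_le_1[of N] by (simp add: power2_eq_square mult_left_le)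
        finally show ?thesis
          using c_nonneg by (simp add: mult_right_mono)
      qed
      have nonneg: "0 \<le> \<mu> x * (grad_sq E w \<mu> \<psi> x + (\<psi> x)\<^sup>2)" for x
        using measure_pos grad_sq_nonneg by (simp add: less_imp_le)
      have "vintegral \<mu> (\<lambda>x. grad_sq E w \<mu> \<psi> x + (\<psi> x)\<^sup>2) \<le> \<epsilon>\<^sup>2 / 2"
      proof (rule vintegral_le_if_sums_bounded[OF nonneg])
        fix G :: "'a set" assume G: "finite G"
        have "(\<Sum>x\<in>G. \<mu> x * (grad_sq E w \<mu> \<psi> x + (\<psi> x)\<^sup>2))
          = (\<Sum>x\<in>G \<inter> F. \<mu> x * (grad_sq E w \<mu> \<psi> x + (\<psi> x)\<^sup>2))
          + (\<Sum>x\<in>G - F. \<mu> x * (grad_sq E w \<mu> \<psi> x + (\<psi> x)\<^sup>2))"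
          using G by (rule sum.Int_Diff)
        also have "\<dots> \<le> (\<Sum>x\<in>G \<inter> F. b N * c x) + (\<Sum>x\<in>G - F. \<mu> x * f x)"
          using le_c le_f measure_pos by (intro add_mono sum_mono mult_left_mono) (auto simp: less_imp_le)
        also have "\<dots> \<le> (\<Sum>x\<in>F. b N * c x) + \<epsilon>\<^sup>2 / 4"
          using G F(1) c_nonneg b_pos[of N]
          by (intro add_mono sum_mono2 less_imp_le[OF F(2)]) (auto simp: less_imp_le)
        also have "\<dots> \<le> \<epsilon>\<^sup>2 / 4 + \<epsilon>\<^sup>2 / 4"
          using N by (simp add: sum_distrib_left)
        finally show "(\<Sum>x\<in>G. \<mu> x * (grad_sq E w \<mu> \<psi> x + (\<psi> x)\<^sup>2)) \<le> \<epsilon>\<^sup>2 / 2"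
          by simp
      qed
      also have "\<dots> < \<epsilon>\<^sup>2"
        using \<open>0 < \<epsilon>\<close> by simp
      finally show ?thesis
        using \<open>0 < \<epsilon>\<close> unfolding H0_norm_def \<psi>_def by (intro real_less_lsqrt) auto
    qed
    then show ?thesis
      by blast
  qed
  ultimately show ?thesis
    unfolding H0_space_def by blast
qed

end

section \<open>Existence of a constrained minimiser\<close>

text \<open>
  Split off the square and bound the remaining power, whose exponent \<open>p - 2\<close> is positive, by its
  value at the largest admissible \<open>\<bar>s\<bar>\<close>.
\<close>

lemma abs_powr_le_square:
  fixes s p K :: real
  assumes "2 < p" "s\<^sup>2 \<le> K"
  shows "\<bar>s\<bar> powr p \<le> K powr ((p - 2) / 2) * s\<^sup>2"
proof (cases "s = 0")
  case False
  have "\<bar>s\<bar> powr p = \<bar>s\<bar> powr (2 * ((p - 2) / 2) + 2)"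
    by (simp add: field_simps)
  also have "\<dots> = (\<bar>s\<bar> powr 2) powr ((p - 2) / 2) * \<bar>s\<bar> powr 2"
    by (simp only: powr_add powr_powr)
  also have "\<bar>s\<bar> powr 2 = s\<^sup>2"
    using False by (simp add: powr_numeral)
  also have "(s\<^sup>2) powr ((p - 2) / 2) * s\<^sup>2 \<le> K powr ((p - 2) / 2) * s\<^sup>2"
    using assms by (intro mult_right_mono powr_mono2) auto
  finally show ?thesis .
qed (use assms in auto)

text \<open>
  The finiteness of the sublevel sets of \<open>h\<close> is the only form in which growth at infinity is used;
  it no longer refers to the distance from a vertex.
\<close>

locale confined_graph = weighted_graph +
  fixes h :: "'a \<Rightarrow> real" and m p \<mu>_min h\<^sub>0 :: real
  assumes m_pos: "0 < m"
    and p_gt_2: "2 < p"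
    and mu_min_pos: "0 < \<mu>_min"
    and mu_min_le: "\<mu>_min \<le> \<mu> x"
    and h0_pos: "0 < h\<^sub>0"
    and h0_le: "h\<^sub>0 \<le> h x"
    and finite_sublevel: "finite {x. h x < R}"
begin

abbreviation finite_mass :: "('a \<Rightarrow> real) \<Rightarrow> bool" where
  "finite_mass u \<equiv> vintegrable \<mu> (\<lambda>x. h x * (u x)\<^sup>2)"

abbreviation mass :: "('a \<Rightarrow> real) \<Rightarrow> real" where
  "mass u \<equiv> vintegral \<mu> (\<lambda>x. h x * (u x)\<^sup>2)"

abbreviation lp_integral :: "('a \<Rightarrow> real) \<Rightarrow> real" where
  "lp_integral u \<equiv> vintegral \<mu> (\<lambda>x. \<bar>u x\<bar> powr p)"

definition energy :: "('a \<Rightarrow> real) \<Rightarrow> real" where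
  "energy u = dirichlet u / 2 - lp_integral u / p"

text \<open>
  The mass is constrained by an inequality: unlike the equality \<open>mass u = m\<close>, it passes to pointwise
  limits, along which mass can be lost at infinity.
\<close>

definition feasible :: "('a \<Rightarrow> real) set" where
  "feasible = {u. finite_mass u \<and> mass u \<le> m \<and> finite_dirichlet u}"

definition minimizer :: "('a \<Rightarrow> real) \<Rightarrow> bool" where
  "minimizer u \<longleftrightarrow> u \<in> feasible \<and> (\<forall>v\<in>feasible. energy u \<le> energy v)"

text \<open>A bound for the square of the supremum of \<open>\<bar>u\<bar>\<close> under the mass constraint.\<close>

definition sup_sq :: real where
  "sup_sq = m / (\<mu>_min * h\<^sub>0)"

text \<open>The \<open>(p - 2)\<close>-th power of the same supremum bound.\<close>

definition sup_factor :: real where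
  "sup_factor = sup_sq powr ((p - 2) / 2)"

lemma h_pos: "0 < h x"
  using h0_pos h0_le[of x] by simp

lemma mass_term_nonneg: "0 \<le> \<mu> x * (h x * (u x)\<^sup>2)"
  using h_pos measure_pos by (simp add: less_imp_le)

lemma lp_integral_term_nonneg: "0 \<le> \<mu> x * \<bar>u x\<bar> powr p"
  using measure_pos by (simp add: less_imp_le)

lemma lp_integral_nonneg: "0 \<le> lp_integral u"
  unfolding vintegral_def by (intro infsum_nonneg) (simp add: lp_integral_term_nonneg)

lemma square_le_sup_sq:
  assumes "finite_mass u" "mass u \<le> m"
  shows "(u x)\<^sup>2 \<le> sup_sq"
proof -
  have "\<mu>_min * h\<^sub>0 * (u x)\<^sup>2 \<le> \<mu> x * h x * (u x)\<^sup>2"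
    using mu_min_le[of x] h0_le[of x] mu_min_pos h0_pos
    by (intro mult_right_mono mult_mono) auto
  also have "\<dots> = (\<Sum>x\<in>{x}. \<mu> x * (h x * (u x)\<^sup>2))"
    by simp
  also have "\<dots> \<le> m"
    using sum_le_vintegral[OF assms(1) mass_term_nonneg[of _ u], of "{x}"] assms(2) by simp
  finally show ?thesis
    using mu_min_pos h0_pos by (simp add: sup_sq_def field_simps)
qed

lemma sup_factor_nonneg: "0 \<le> sup_factor"
  by (simp add: sup_factor_def)

text \<open>
  Where \<open>h\<close> is at least \<open>R\<close>, the \<open>p\<close>-th power is at most \<open>sup_factor / R\<close> times the density of the
  mass. The resulting bound is uniform over the feasible functions and tends to \<open>0\<close> as \<open>R\<close> grows, so
  no part of the \<open>p\<close>-th power escapes to infinity; this replaces the compact embedding of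
  \<open>H\<close> into \<open>L\<^sup>p\<close>.
\<close>

lemma lp_integral_sum_le:
  assumes "finite_mass u" "mass u \<le> m" "finite A" "0 < R" "\<And>x. x \<in> A \<Longrightarrow> R \<le> h x"
  shows "(\<Sum>x\<in>A. \<mu> x * \<bar>u x\<bar> powr p) \<le> sup_factor * m / R"
proof -
  have "\<mu> x * \<bar>u x\<bar> powr p \<le> sup_factor / R * (\<mu> x * (h x * (u x)\<^sup>2))" if "x \<in> A" for x
  proof -
    have "\<bar>u x\<bar> powr p \<le> sup_factor * (u x)\<^sup>2"
      unfolding sup_factor_def using p_gt_2 square_le_sup_sq[OF assms(1,2)]
      by (rule abs_powr_le_square)
    also have "(u x)\<^sup>2 \<le> h x / R * (u x)\<^sup>2"
      using assms(4) assms(5)[OF that] mult_right_mono[of 1 "h x / R" "(u x)\<^sup>2"] by simp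
    finally have "\<bar>u x\<bar> powr p \<le> sup_factor * (h x / R * (u x)\<^sup>2)"
      using sup_factor_nonneg by (simp add: mult_left_mono)
    then have "\<mu> x * \<bar>u x\<bar> powr p \<le> \<mu> x * (sup_factor * (h x / R * (u x)\<^sup>2))"
      using measure_pos[of x] by (intro mult_left_mono) auto
    then show ?thesis
      by (simp add: mult_ac)
  qed
  then have "(\<Sum>x\<in>A. \<mu> x * \<bar>u x\<bar> powr p)
      \<le> sup_factor / R * (\<Sum>x\<in>A. \<mu> x * (h x * (u x)\<^sup>2))"
    by (simp add: sum_distrib_left sum_mono)
  also have "\<dots> \<le> sup_factor / R * m"
    using sum_le_vintegral[OF assms(1) mass_term_nonneg[of _ u] assms(3)] assms(2,4) sup_factor_nonneg
    by (intro mult_left_mono) auto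
  finally show ?thesis
    by simp
qed

lemma
  assumes "finite_mass u" "mass u \<le> m"
  shows finite_lp_integral: "vintegrable \<mu> (\<lambda>x. \<bar>u x\<bar> powr p)"
    and lp_integral_le: "lp_integral u \<le> sup_factor * m / h\<^sub>0"
  using lp_integral_sum_le[OF assms _ h0_pos h0_le] lp_integral_term_nonneg
  by (blast intro: vintegrable_if_sums_bounded vintegral_le_if_sums_bounded)+

lemma lp_integral_le_sum_plus_tail:
  assumes "finite_mass u" "mass u \<le> m" "finite F" "0 < R" "{x. h x < R} \<subseteq> F"
  shows "lp_integral u \<le> (\<Sum>x\<in>F. \<mu> x * \<bar>u x\<bar> powr p) + sup_factor * m / R"
proof (rule vintegral_le_if_sums_bounded[OF lp_integral_term_nonneg])
  fix G :: "'a set" assume G: "finite G"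
  have "(\<Sum>x\<in>G. \<mu> x * \<bar>u x\<bar> powr p)
    = (\<Sum>x\<in>G \<inter> F. \<mu> x * \<bar>u x\<bar> powr p) + (\<Sum>x\<in>G - F. \<mu> x * \<bar>u x\<bar> powr p)"
    using G by (rule sum.Int_Diff)
  also have "(\<Sum>x\<in>G \<inter> F. \<mu> x * \<bar>u x\<bar> powr p) \<le> (\<Sum>x\<in>F. \<mu> x * \<bar>u x\<bar> powr p)"
    using assms(3) lp_integral_term_nonneg by (intro sum_mono2) auto
  also have "(\<Sum>x\<in>G - F. \<mu> x * \<bar>u x\<bar> powr p) \<le> sup_factor * m / R"
    using assms G by (intro lp_integral_sum_le) (auto simp: not_less[symmetric])
  finally show "(\<Sum>x\<in>G. \<mu> x * \<bar>u x\<bar> powr p)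
    \<le> (\<Sum>x\<in>F. \<mu> x * \<bar>u x\<bar> powr p) + sup_factor * m / R"
    by simp
qed

lemma zero_feasible: "(\<lambda>_. 0) \<in> feasible"
  using m_pos vintegral_eq_0[of "\<lambda>_. 0" \<mu>]
  by (simp add: feasible_def grad_sq_def[abs_def])

lemma energy_bdd_below: "bdd_below (energy ` feasible)"
proof (intro bdd_belowI2)
  fix u assume "u \<in> feasible"
  then have "lp_integral u / p \<le> sup_factor * m / h\<^sub>0 / p"
    using lp_integral_le p_gt_2 by (intro divide_right_mono) (auto simp: feasible_def)
  then show "- (sup_factor * m / h\<^sub>0 / p) \<le> energy u"
    using dirichlet_nonneg[of u] by (simp add: energy_def)
qed

text \<open>Tychonoff's theorem, for the topology of pointwise convergence.\<close>

lemma compact_box: "compact {u :: 'a \<Rightarrow> real. \<forall>x. \<bar>u x\<bar> \<le> C}"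
proof -
  have "compactin (product_topology (\<lambda>i::'a. euclidean) UNIV) (PiE UNIV (\<lambda>_. {- C..C}))"
    by (simp add: compactin_PiE)
  moreover have "PiE UNIV (\<lambda>_. {- C..C}) = {u :: 'a \<Rightarrow> real. \<forall>x. \<bar>u x\<bar> \<le> C}"
    by (auto simp: PiE_def Pi_def abs_le_iff minus_le_iff)
  ultimately show ?thesis
    by (simp add: euclidean_product_topology)
qed

text \<open>
  Feasible functions lie in a box that is compact for pointwise convergence. The energy is an infinite
  sum and not continuous there, so near-minimality is expressed by conditions \<open>T (F, R)\<close> on finitely
  many vertices: the mass and the energy are truncated to a finite set \<open>F\<close> that contains
  \<open>{x. h x < R}\<close>, and the energy is allowed to exceed the infimum by \<open>C / R\<close>. By the uniform tail bound,
  a function whose energy is within \<open>1 / R\<close> of the infimum satisfies \<open>T (F, R)\<close>; hence finitely many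
  of these closed conditions are always compatible, and by compactness all of them are. Letting first
  \<open>F\<close> and then \<open>R\<close> grow shows that a function satisfying all of them attains the infimum.
\<close>

lemma minimizer_exists: "\<exists>u. minimizer u"
proof -
  define I where "I = Inf (energy ` feasible)"
  define C where "C = 1 + sup_factor * m / p"
  define T where "T = (\<lambda>(F, R). {u. (\<Sum>x\<in>F. \<mu> x * (h x * (u x)\<^sup>2)) \<le> m \<and>
      (\<Sum>x\<in>F. \<mu> x * grad_sq E w \<mu> u x) / 2 - (\<Sum>x\<in>F. \<mu> x * \<bar>u x\<bar> powr p) / p \<le> I + C / R})"
  define Idx where "Idx = {(F, R). finite F \<and> 0 < R \<and> {x. h x < R} \<subseteq> F}"
  let ?U = "{u :: 'a \<Rightarrow> real. \<forall>x. \<bar>u x\<bar> \<le> sqrt sup_sq}"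

  have closed: "closed (T i)" if "i \<in> Idx" for i
    unfolding T_def grad_sq_def case_prod_beta using p_gt_2
    by (intro closed_Collect_conj closed_Collect_le continuous_intros continuous_on_powr'
        continuous_on_product_coordinates) auto

  have fip: "?U \<inter> (\<Inter>i\<in>J. T i) \<noteq> {}" if J: "finite J" "J \<subseteq> Idx" for J
  proof -
    \<comment> \<open>The \<open>1\<close> only keeps the set nonempty when \<open>J\<close> is empty.\<close>
    define \<epsilon> where "\<epsilon> = Min (insert 1 ((\<lambda>i. 1 / snd i) ` J))"
    have \<epsilon>_pos: "0 < \<epsilon>"
      unfolding \<epsilon>_def using J by (subst Min_gr_iff) (auto simp: Idx_def)
    have \<epsilon>_le: "\<epsilon> \<le> 1 / R" if "(F, R) \<in> J" for F R
      unfolding \<epsilon>_def using J(1) that by (intro Min_le) force+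
    have "\<exists>a\<in>energy ` feasible. a < I + \<epsilon>"
      unfolding I_def using \<epsilon>_pos zero_feasible by (intro cInf_lessD) auto
    then obtain u where u: "u \<in> feasible" "energy u < I + \<epsilon>"
      by blast
    then have mass: "finite_mass u" "mass u \<le> m" and D: "finite_dirichlet u"
      by (auto simp: feasible_def)
    have "u \<in> T (F, R)" if FR: "(F, R) \<in> J" for F R
    proof -
      have F: "finite F" "0 < R" "{x. h x < R} \<subseteq> F"
        using FR J(2) by (auto simp: Idx_def)
      have "(\<Sum>x\<in>F. \<mu> x * grad_sq E w \<mu> u x) \<le> dirichlet u"
        using D measure_grad_sq_nonneg F(1) by (rule sum_le_vintegral)
      moreover have "lp_integral u / p
          \<le> (\<Sum>x\<in>F. \<mu> x * \<bar>u x\<bar> powr p) / p + sup_factor * m / R / p"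
        using divide_right_mono[OF lp_integral_le_sum_plus_tail[OF mass F], of p] p_gt_2
        by (simp add: add_divide_distrib)
      moreover have "C / R = 1 / R + sup_factor * m / R / p"
        by (simp add: C_def add_divide_distrib)
      ultimately have "(\<Sum>x\<in>F. \<mu> x * grad_sq E w \<mu> u x) / 2
          - (\<Sum>x\<in>F. \<mu> x * \<bar>u x\<bar> powr p) / p \<le> I + C / R"
        using u(2) \<epsilon>_le[OF FR] unfolding energy_def by linarith
      moreover have "(\<Sum>x\<in>F. \<mu> x * (h x * (u x)\<^sup>2)) \<le> m"
        using sum_le_vintegral[OF mass(1) mass_term_nonneg[of _ u] F(1)] mass(2) by simp
      ultimately show ?thesis
        by (simp add: T_def)
    qed
    moreover have "\<bar>u x\<bar> \<le> sqrt sup_sq" for x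
      using square_le_sup_sq[OF mass, of x] by (rule real_le_rsqrt[of "\<bar>u x\<bar>", simplified])
    ultimately show ?thesis
      by fast
  qed
  have "?U \<inter> (\<Inter>i\<in>Idx. T i) \<noteq> {}"
    by (rule compact_imp_fip_image[OF compact_box closed fip])
  then obtain u where "u \<in> ?U \<inter> (\<Inter>i\<in>Idx. T i)"
    unfolding ex_in_conv[symmetric] ..
  then have u: "u \<in> T i" if "i \<in> Idx" for i
    using that by simp
  have T: "(\<Sum>x\<in>F \<union> {x. h x < R}. \<mu> x * (h x * (u x)\<^sup>2)) \<le> m"
    "(\<Sum>x\<in>F \<union> {x. h x < R}. \<mu> x * grad_sq E w \<mu> u x) / 2
      - (\<Sum>x\<in>F \<union> {x. h x < R}. \<mu> x * \<bar>u x\<bar> powr p) / p \<le> I + C / R"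
    if "finite F" "0 < R" for F R
  proof -
    have "(F \<union> {x. h x < R}, R) \<in> Idx"
      using that finite_sublevel by (simp add: Idx_def)
    from u[OF this] show "(\<Sum>x\<in>F \<union> {x. h x < R}. \<mu> x * (h x * (u x)\<^sup>2)) \<le> m"
      "(\<Sum>x\<in>F \<union> {x. h x < R}. \<mu> x * grad_sq E w \<mu> u x) / 2
        - (\<Sum>x\<in>F \<union> {x. h x < R}. \<mu> x * \<bar>u x\<bar> powr p) / p \<le> I + C / R"
      by (simp_all only: T_def case_prod_conv mem_Collect_eq)
  qed
  have "(\<Sum>x\<in>F. \<mu> x * (h x * (u x)\<^sup>2)) \<le> m" if F: "finite F" for F
  proof -
    have "(\<Sum>x\<in>F. \<mu> x * (h x * (u x)\<^sup>2)) \<le> (\<Sum>x\<in>F \<union> {x. h x < 1}. \<mu> x * (h x * (u x)\<^sup>2))"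
      using F finite_sublevel mass_term_nonneg by (intro sum_mono2) auto
    also have "\<dots> \<le> m"
      using T(1)[OF F, of 1] by simp
    finally show ?thesis .
  qed
  then have mass: "finite_mass u" "mass u \<le> m"
    using mass_term_nonneg by (blast intro: vintegrable_if_sums_bounded vintegral_le_if_sums_bounded)+
  have bound: "(\<Sum>x\<in>F. \<mu> x * grad_sq E w \<mu> u x) \<le> 2 * (I + lp_integral u / p)" if F: "finite F" for F
  proof (rule field_le_epsilon)
    fix e :: real assume e: "0 < e"
    define R where "R = 2 * C / e"
    have C: "0 < C"
      using sup_factor_nonneg m_pos p_gt_2 by (auto simp: C_def intro!: add_pos_nonneg)
    then have R: "0 < R" "C / R = e / 2"
      using e by (simp_all add: R_def)
    let ?F = "F \<union> {x. h x < R}"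
    have "(\<Sum>x\<in>?F. \<mu> x * grad_sq E w \<mu> u x) / 2
        \<le> I + e / 2 + (\<Sum>x\<in>?F. \<mu> x * \<bar>u x\<bar> powr p) / p"
      using T(2)[OF F R(1)] R(2) by simp
    moreover have "(\<Sum>x\<in>F. \<mu> x * grad_sq E w \<mu> u x) \<le> (\<Sum>x\<in>?F. \<mu> x * grad_sq E w \<mu> u x)"
      using F finite_sublevel measure_grad_sq_nonneg by (intro sum_mono2) auto
    moreover have "(\<Sum>x\<in>?F. \<mu> x * \<bar>u x\<bar> powr p) / p \<le> lp_integral u / p"
      using sum_le_vintegral[OF finite_lp_integral[OF mass] lp_integral_term_nonneg[of _ u], of ?F]
        F finite_sublevel p_gt_2 by (intro divide_right_mono) auto
    ultimately show "(\<Sum>x\<in>F. \<mu> x * grad_sq E w \<mu> u x) \<le> 2 * (I + lp_integral u / p) + e"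
      by argo
  qed
  have "finite_dirichlet u" "dirichlet u \<le> 2 * (I + lp_integral u / p)"
    using bound measure_grad_sq_nonneg
    by (blast intro: vintegrable_if_sums_bounded vintegral_le_if_sums_bounded)+
  then have "u \<in> feasible" "energy u \<le> I"
    using mass by (auto simp: feasible_def energy_def)
  moreover have "I \<le> energy v" if "v \<in> feasible" for v
    unfolding I_def using that energy_bdd_below by (intro cInf_lower) auto
  ultimately have "minimizer u"
    unfolding minimizer_def by (meson order_trans)
  then show ?thesis
    by blast
qed

section \<open>Properties of minimisers\<close>

text \<open>Taking absolute values shrinks all increments and keeps the other two integrals.\<close>

lemma minimizer_abs:
  assumes "minimizer u"
  shows "minimizer (\<lambda>x. \<bar>u x\<bar>)"
proof -
  have u: "finite_mass u" "mass u \<le> m" "finite_dirichlet u"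
    using assms by (auto simp: minimizer_def feasible_def)
  have le: "grad_sq E w \<mu> (\<lambda>x. \<bar>u x\<bar>) x \<le> grad_sq E w \<mu> u x" for x
    by (intro grad_sq_mono) linarith
  have "finite_dirichlet (\<lambda>x. \<bar>u x\<bar>)" "dirichlet (\<lambda>x. \<bar>u x\<bar>) \<le> dirichlet u"
    using u(3) measure_pos grad_sq_nonneg le by (rule vintegrable_dominated, rule vintegral_mono)
  then show ?thesis
    using u assms by (force simp: energy_def minimizer_def feasible_def)
qed

lemma mass_scale: "mass (\<lambda>x. c * u x) = c\<^sup>2 * mass u"
  and finite_mass_scale: "finite_mass u \<Longrightarrow> finite_mass (\<lambda>x. c * u x)"
proof -
  have eq: "(\<lambda>x. h x * (c * u x)\<^sup>2) = (\<lambda>x. c\<^sup>2 * (h x * (u x)\<^sup>2))"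
    by (simp add: power_mult_distrib algebra_simps)
  show "mass (\<lambda>x. c * u x) = c\<^sup>2 * mass u"
    unfolding eq by (rule vintegral_cmult)
  show "finite_mass (\<lambda>x. c * u x)" if "finite_mass u"
    unfolding eq using that by (rule vintegrable_cmult)
qed

lemma scale_feasible:
  assumes "finite_mass u" "finite_dirichlet u" "c\<^sup>2 * mass u \<le> m"
  shows "(\<lambda>x. c * u x) \<in> feasible"
  unfolding feasible_def grad_sq_scale mem_Collect_eq mass_scale
  using assms finite_mass_scale vintegrable_cmult by blast

lemma energy_scale:
  "energy (\<lambda>x. c * u x) = c\<^sup>2 * dirichlet u / 2 - \<bar>c\<bar> powr p * lp_integral u / p"
  unfolding energy_def grad_sq_scale vintegral_cmult
  by (simp add: abs_mult powr_mult vintegral_cmult)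

text \<open>
  If some mass is left over, multiply by a \<open>t > 1\<close> that is still admissible. As \<open>t powr p \<ge> t\<^sup>2\<close>,
  the energy becomes at most \<open>t\<^sup>2\<close> times the old one, which is strictly smaller when the old one is
  negative.
\<close>

lemma negative_minimizer_saturates:
  assumes "minimizer u" "energy u < 0"
  shows "mass u = m"
proof (rule ccontr)
  assume "mass u \<noteq> m"
  moreover have u: "finite_mass u" "mass u \<le> m" "finite_dirichlet u"
    using assms by (auto simp: minimizer_def feasible_def)
  ultimately have less: "mass u < m"
    by simp
  have nonneg: "0 \<le> mass u"
    unfolding vintegral_def by (intro infsum_nonneg) (simp add: mass_term_nonneg)
  \<comment> \<open>The new mass \<open>2 * m * mass u / (mass u + m)\<close> is at most \<open>m\<close>, also when \<open>mass u = 0\<close>.\<close>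
  define t where "t = sqrt (2 * m / (mass u + m))"
  have t2: "t\<^sup>2 = 2 * m / (mass u + m)"
    using m_pos nonneg by (simp add: t_def)
  have t_gt_1: "1 < t"
    using m_pos nonneg less by (simp add: t_def)
  have "t\<^sup>2 * mass u \<le> m"
    unfolding t2 using m_pos nonneg less by (simp add: field_simps)
  then have "(\<lambda>x. t * u x) \<in> feasible"
    using u by (intro scale_feasible)
  then have "energy u \<le> energy (\<lambda>x. t * u x)"
    using assms(1) by (simp add: minimizer_def)
  also have "\<dots> = t\<^sup>2 * dirichlet u / 2 - t powr p * lp_integral u / p"
    using t_gt_1 by (simp add: energy_scale)
  also have "\<dots> \<le> t\<^sup>2 * dirichlet u / 2 - t\<^sup>2 * lp_integral u / p"
  proof -
    have "t\<^sup>2 \<le> t powr p"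
      using t_gt_1 p_gt_2 powr_mono[of 2 p t] by (simp add: powr_numeral)
    then show ?thesis
      using lp_integral_nonneg p_gt_2 by (intro diff_left_mono divide_right_mono mult_right_mono) auto
  qed
  also have "\<dots> = t\<^sup>2 * energy u"
    by (simp add: energy_def algebra_simps)
  also have "\<dots> < 1 * energy u"
    using assms(2) t_gt_1 by (intro mult_strict_right_mono_neg) auto
  finally show False
    by simp
qed

end

context weighted_graph
begin

section \<open>The strong maximum principle\<close>

text \<open>
  At a zero of a nonnegative function the Laplacian is a sum of nonnegative terms, one for each
  neighbour, so it vanishes only if all of them do.
\<close>

lemma laplacian_eq_0_imp_nbrs_eq_0:
  assumes "\<And>x. 0 \<le> u x" "u z = 0" "laplacian E w \<mu> u z = 0" "(z, y) \<in> E"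
  shows "u y = 0"
proof -
  have "(\<Sum>y\<in>nbrs z. w z y * u y) = 0"
    using assms(2,3) measure_pos[of z] by (simp add: laplacian_def)
  then have "\<forall>y\<in>nbrs z. w z y * u y = 0"
    using assms(1) weight_pos finite_nbrs
    by (subst (asm) sum_nonneg_eq_0_iff) (auto simp: less_imp_le)
  then show ?thesis
    using assms(4) weight_pos[OF assms(4)] by force
qed

text \<open>By connectedness a single zero would spread along walks to every vertex.\<close>

lemma positive_if_harmonic_at_zeros:
  assumes "connected_graph E" "\<And>x. 0 \<le> u x" "u a \<noteq> 0"
    and "\<And>z. u z = 0 \<Longrightarrow> laplacian E w \<mu> u z = 0"
  shows "0 < u x"
proof (rule ccontr)
  assume "\<not> 0 < u x"
  then have 0: "u x = 0"
    using assms(2)[of x] by simp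
  have "(x, a) \<in> E\<^sup>*"
    using assms(1) by (simp add: connected_graph_def)
  then have "u a = 0"
    by (induction rule: rtrancl_induct) (use 0 laplacian_eq_0_imp_nbrs_eq_0 assms(2,4) in blast)+
  then show False
    using assms(3) by simp
qed

end

section \<open>The Euler--Lagrange equation\<close>

text \<open>
  A nonnegative function is differentiated at vertices where it may vanish, in both directions. There
  the exponent \<open>p > 1\<close> makes \<open>\<bar>s\<bar> powr p\<close> differentiable, and the derivative agrees with the usual
  formula because \<open>0 powr (p - 1) = 0\<close>.
\<close>

lemma has_real_derivative_abs_powr:
  fixes a p :: real
  assumes "0 \<le> a" "1 < p"
  shows "((\<lambda>s. \<bar>s\<bar> powr p) has_real_derivative p * a powr (p - 1)) (at a)"
proof (cases "a = 0")
  case True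
  have "((\<lambda>s. \<bar>s\<bar> powr (p - 1)) \<longlongrightarrow> 0) (at (0::real))"
    using assms(2) by (intro tendsto_zero_powrI tendsto_rabs_zero) auto
  then have "((\<lambda>s. \<bar>s\<bar> powr p / s) \<longlongrightarrow> 0) (at (0::real))"
  proof (rule Lim_null_comparison[rotated])
    have "norm (\<bar>s\<bar> powr p / s) \<le> \<bar>s\<bar> powr (p - 1)" for s
      by (cases "s = 0") (simp_all add: powr_diff abs_divide)
    then show "\<forall>\<^sub>F s in at 0. norm (\<bar>s\<bar> powr p / s) \<le> \<bar>s\<bar> powr (p - 1)"
      by simp
  qed
  then show ?thesis
    using True by (simp add: has_field_derivative_iff)
next
  case False
  then have "((\<lambda>s. s powr p) has_real_derivative p * a powr (p - 1)) (at a)"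
    using assms(1) by (intro has_real_derivative_powr) simp
  moreover have "\<forall>\<^sub>F s in nhds a. \<bar>s\<bar> powr p = s powr p"
    using False assms(1) eventually_nhds_in_open[of "{0<..}" a] by (auto elim!: eventually_mono)
  ultimately show ?thesis
    by (subst DERIV_cong_ev[OF refl _ refl]) auto
qed

context confined_graph
begin

lemma finite_mass_fun_upd: "finite_mass u \<Longrightarrow> finite_mass (u(z := s))"
  and mass_fun_upd: "finite_mass u \<Longrightarrow>
    mass (u(z := s)) = mass u + \<mu> z * h z * (s\<^sup>2 - (u z)\<^sup>2)"
  and lp_integral_fun_upd: "vintegrable \<mu> (\<lambda>x. \<bar>u x\<bar> powr p) \<Longrightarrow>
    lp_integral (u(z := s)) = lp_integral u + \<mu> z * (\<bar>s\<bar> powr p - \<bar>u z\<bar> powr p)"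
proof -
  show "finite_mass (u(z := s))" if "finite_mass u"
    using that by (rule vintegrable_modify_finite[of _ _ "{z}"]) auto
  show "mass (u(z := s)) = mass u + \<mu> z * h z * (s\<^sup>2 - (u z)\<^sup>2)" if "finite_mass u"
    using that by (subst vintegral_modify_finite[of _ _ "{z}"]) (auto simp: algebra_simps)
  show "lp_integral (u(z := s)) = lp_integral u + \<mu> z * (\<bar>s\<bar> powr p - \<bar>u z\<bar> powr p)"
    if "vintegrable \<mu> (\<lambda>x. \<bar>u x\<bar> powr p)"
    using that by (subst vintegral_modify_finite[of _ _ "{z}"]) (auto simp: algebra_simps)
qed

text \<open>
  Rescaling a competitor of positive mass to mass \<open>m\<close> removes the constraint: the minimiser is compared
  with all such functions, through an expression that is invariant under scaling.
\<close>

lemma energy_le_rescaled: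
  assumes "minimizer u" "finite_mass v" "finite_dirichlet v" "0 < mass v"
  shows "energy u \<le> m / mass v * dirichlet v / 2
    - (m / mass v) powr (p / 2) * lp_integral v / p"
proof -
  let ?c = "sqrt (m / mass v)"
  have c2: "?c\<^sup>2 = m / mass v"
    using assms(4) m_pos by simp
  have "(\<lambda>x. ?c * v x) \<in> feasible"
    using assms by (intro scale_feasible) (simp_all add: c2)
  then have "energy u \<le> energy (\<lambda>x. ?c * v x)"
    using assms(1) by (simp add: minimizer_def)
  also have "\<bar>?c\<bar> powr p = (m / mass v) powr (p / 2)"
    using assms(4) m_pos by (simp add: powr_half_sqrt[symmetric] powr_powr del: real_sqrt_divide)
  then have "energy (\<lambda>x. ?c * v x) = m / mass v * dirichlet v / 2
    - (m / mass v) powr (p / 2) * lp_integral v / p"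
    unfolding energy_scale c2 by simp
  finally show ?thesis .
qed

text \<open>
  Vary the value at the single vertex \<open>z\<close>. By the previous lemma the function \<open>F\<close> of that value, built
  from the mass \<open>q\<close>, the Dirichlet energy \<open>d\<close> and the \<open>p\<close>-th power integral \<open>b\<close> of the varied function,
  has a local minimum at \<open>u z\<close>; its derivative there is \<open>\<mu> z\<close> times the difference of the two sides.
  The multiplier comes from differentiating the scaling factor \<open>m / q\<close>, which appears with exponent \<open>1\<close>
  in front of \<open>d / 2\<close> and with exponent \<open>p / 2\<close> in front of \<open>b / p\<close>.
\<close>

lemma Euler_Lagrange:
  assumes u: "minimizer u" "mass u = m" "\<And>x. 0 \<le> u x"
  shows "- laplacian E w \<mu> u z + (lp_integral u - dirichlet u) / m * h z * u z = u z powr (p - 1)"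
proof -
  have fin: "finite_mass u" "finite_dirichlet u" "vintegrable \<mu> (\<lambda>x. \<bar>u x\<bar> powr p)"
    using u(1) finite_lp_integral by (auto simp: minimizer_def feasible_def)
  define a where "a = u z"
  define q where "q s = m + \<mu> z * h z * (s\<^sup>2 - a\<^sup>2)" for s
  define d where "d s = dirichlet u + (\<Sum>y\<in>nbrs z - {z}. w z y * ((u y - s)\<^sup>2 - (u y - a)\<^sup>2))" for s
  define b where "b s = lp_integral u + \<mu> z * (\<bar>s\<bar> powr p - \<bar>a\<bar> powr p)" for s
  define F where "F s = m / q s * d s / 2 - (m / q s) powr (p / 2) * b s / p" for s
  define q' where "q' = 2 * \<mu> z * h z * a"
  define d' where "d' = - 2 * \<mu> z * laplacian E w \<mu> u z"
  define b' where "b' = p * \<mu> z * a powr (p - 1)"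
  have at_a: "q a = m" "d a = dirichlet u" "b a = lp_integral u"
    by (simp_all add: q_def d_def b_def)
  have F_eq: "F s = m / mass (u(z := s)) * dirichlet (u(z := s)) / 2
      - (m / mass (u(z := s))) powr (p / 2) * lp_integral (u(z := s)) / p"
    and q_eq: "q s = mass (u(z := s))" for s
    by (simp_all only: F_def q_def d_def b_def a_def u(2)
        mass_fun_upd[OF fin(1)] dirichlet_fun_upd[OF fin(2)] lp_integral_fun_upd[OF fin(3)])
  have F_a: "F a = energy u"
    using m_pos by (simp add: F_def at_a energy_def)

  have q_deriv: "(q has_real_derivative q') (at a)"
    unfolding q_def q'_def by (auto intro!: derivative_eq_intros)
  have d_deriv: "(d has_real_derivative d') (at a)"
  proof -
    have "(d has_real_derivative (\<Sum>y\<in>nbrs z - {z}. - 2 * (w z y * (u y - a)))) (at a)"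
      unfolding d_def by (auto intro!: derivative_eq_intros simp: algebra_simps)
    also have "(\<Sum>y\<in>nbrs z - {z}. - 2 * (w z y * (u y - a))) = - 2 * (\<Sum>y\<in>nbrs z - {z}. w z y * (u y - a))"
      by (rule sum_distrib_left[symmetric])
    \<comment> \<open>A loop at \<open>z\<close> may be put back, as its increment is \<open>0\<close>.\<close>
    also have "(\<Sum>y\<in>nbrs z - {z}. w z y * (u y - a)) = (\<Sum>y\<in>nbrs z. w z y * (u y - a))"
      using finite_nbrs by (intro sum.mono_neutral_left) (auto simp: a_def)
    also have "- 2 * (\<Sum>y\<in>nbrs z. w z y * (u y - a)) = d'"
      using measure_pos[of z] by (simp add: d'_def laplacian_def a_def)
    finally show ?thesis .
  qed
  have b_deriv: "(b has_real_derivative b') (at a)"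
  proof -
    have "((\<lambda>s. \<bar>s\<bar> powr p) has_real_derivative p * a powr (p - 1)) (at a)"
      using u(3) p_gt_2 by (intro has_real_derivative_abs_powr) (auto simp: a_def)
    from DERIV_add[OF DERIV_const DERIV_cmult[OF DERIV_diff[OF this DERIV_const]]]
    have "(b has_real_derivative 0 + \<mu> z * (p * a powr (p - 1) - 0)) (at a)"
      unfolding b_def .
    then show ?thesis
      by (simp add: b'_def mult_ac)
  qed
  have r_deriv: "((\<lambda>s. m / q s) has_real_derivative - q' / m) (at a)"
    using m_pos by (auto intro!: derivative_eq_intros q_deriv simp: at_a field_simps)
  have "((\<lambda>s. (m / q s) powr (p / 2)) has_real_derivative p / 2 * (m / q a) powr (p / 2 - 1) * (- q' / m)) (at a)"
    using m_pos by (intro DERIV_chain2[OF has_real_derivative_powr r_deriv]) (simp add: at_a)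
  then have rp_deriv: "((\<lambda>s. (m / q s) powr (p / 2)) has_real_derivative p / 2 * (- q' / m)) (at a)"
    using m_pos by (simp add: at_a)
  let ?F' = "(- q' / m * dirichlet u + d') / 2 - (p / 2 * (- q' / m) * lp_integral u + b') / p"
  have F_deriv: "(F has_real_derivative ?F') (at a)"
    using DERIV_diff[OF DERIV_cdivide[OF DERIV_mult[OF r_deriv d_deriv], of 2]
        DERIV_cdivide[OF DERIV_mult[OF rp_deriv b_deriv], of p]] m_pos
    unfolding F_def[abs_def] by (simp add: at_a)

  have "isCont q a"
    using q_deriv by (rule DERIV_isCont)
  then have "\<forall>\<^sub>F s in nhds a. 0 < q s"
    using m_pos at_a(1) by (auto simp: continuous_at tendsto_at_iff_tendsto_nhds intro: order_tendstoD(1))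
  then obtain \<delta> where \<delta>: "0 < \<delta>" "\<And>s. dist s a < \<delta> \<Longrightarrow> 0 < q s"
    unfolding eventually_nhds_metric by blast
  have "F a \<le> F s" if "\<bar>a - s\<bar> < \<delta>" for s
  proof -
    have "0 < mass (u(z := s))"
      using that \<delta>(2)[of s] unfolding q_eq[symmetric] by (simp add: dist_real_def abs_minus_commute)
    then show ?thesis
      unfolding F_a F_eq[of s]
      by (rule energy_le_rescaled[OF u(1) finite_mass_fun_upd[OF fin(1)] finite_dirichlet_fun_upd[OF fin(2)]])
  qed
  then have "?F' = 0"
    using F_deriv \<delta>(1) by (intro DERIV_local_min) auto
  moreover have "?F' = \<mu> z * (- laplacian E w \<mu> u z + (lp_integral u - dirichlet u) / m * h z * a - a powr (p - 1))"
    using m_pos p_gt_2 by (simp add: q'_def d'_def b'_def field_simps)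
  ultimately have "\<mu> z * (- laplacian E w \<mu> u z + (lp_integral u - dirichlet u) / m * h z * a - a powr (p - 1)) = 0"
    by (simp only:)
  then have "- laplacian E w \<mu> u z + (lp_integral u - dirichlet u) / m * h z * a - a powr (p - 1) = 0"
    using measure_pos[of z] by (simp only: mult_eq_0_iff less_irrefl) auto
  then show ?thesis
    by (simp add: a_def)
qed

section \<open>A competitor of negative energy, and the solution\<close>

text \<open>
  The competitor is concentrated at \<open>z\<close>, with the height \<open>c\<close> that gives it mass \<open>m\<close>. Its energy is at
  most \<open>c\<^sup>2 * wdeg E w z / 2 - \<mu> z * c powr p / p\<close>, and the hypothesis, raised to the power \<open>(p - 2) / 2\<close>,
  says exactly that this is negative.
\<close>

lemma spike_negative:
  assumes "h z < m * (2 / p * (\<mu> z powr (2 - p / 2) / wdeg E w z)) powr (2 / (p - 2))"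
  shows "\<exists>v\<in>feasible. energy v < 0"
proof -
  define c where "c = sqrt (m / (\<mu> z * h z))"
  define X where "X = 2 / p * (\<mu> z powr (2 - p / 2) / wdeg E w z)"
  define v where "v = (\<lambda>_. 0)(z := c)"
  have c: "0 < c" "c\<^sup>2 = m / (\<mu> z * h z)"
    using m_pos measure_pos[of z] h_pos[of z] by (simp_all add: c_def)
  have zero: "finite_mass (\<lambda>_. 0)" "mass (\<lambda>_. 0) = 0" "lp_integral (\<lambda>_. 0) = 0"
    "vintegrable \<mu> (\<lambda>x. \<bar>0::real\<bar> powr p)"
    "finite_dirichlet (\<lambda>_. 0)" "dirichlet (\<lambda>_. 0) = 0"
    by (auto intro!: vintegral_eq_0 simp: grad_sq_def)
  have wdeg_nonneg: "0 \<le> wdeg E w z"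
    unfolding wdeg_def using weight_pos by (intro sum_nonneg) (auto simp: less_imp_le)
  \<comment> \<open>For degree \<open>0\<close> the right-hand side of the hypothesis is \<open>0\<close>, by the conventions for division and powers.\<close>
  have deg: "0 < wdeg E w z"
    using assms h_pos[of z] wdeg_nonneg by (cases "wdeg E w z = 0") auto
  then have X: "0 < X"
    using p_gt_2 measure_pos[of z] by (simp add: X_def)
  have "h z / m < X powr (2 / (p - 2))"
    using assms m_pos by (simp add: X_def field_simps)
  then have "(h z / m) powr ((p - 2) / 2) < (X powr (2 / (p - 2))) powr ((p - 2) / 2)"
    using h_pos[of z] m_pos p_gt_2 by (intro powr_less_mono2) auto
  also have "\<dots> = X powr (2 / (p - 2) * ((p - 2) / 2))"
    by (rule powr_powr)
  also have "2 / (p - 2) * ((p - 2) / 2) = 1"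
    using p_gt_2 by simp
  also have "X powr 1 = X"
    using X by simp
  finally have hX: "(h z / m) powr ((p - 2) / 2) < X" .
  have "wdeg E w z / 2 < \<mu> z * c powr (p - 2) / p"
  proof -
    have "c powr (p - 2) = c powr (2 * ((p - 2) / 2))"
      by (simp only: times_divide_eq_right nonzero_mult_div_cancel_left zero_neq_numeral not_False_eq_True)
    also have "\<dots> = (c\<^sup>2) powr ((p - 2) / 2)"
      using c(1) by (simp only: powr_powr[symmetric] powr_numeral)
    also have "\<dots> = (m / h z) powr ((p - 2) / 2) * (1 / \<mu> z) powr ((p - 2) / 2)"
      using m_pos h_pos[of z] measure_pos[of z] by (simp add: c(2) powr_mult[symmetric] mult.commute)
    also have "(1 / \<mu> z) powr ((p - 2) / 2) = \<mu> z powr (2 - p / 2) / \<mu> z"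
    proof -
      have "(1 / \<mu> z) powr ((p - 2) / 2) = \<mu> z powr (- ((p - 2) / 2))"
        using measure_pos[of z] by (simp add: powr_minus_divide powr_divide)
      also have "- ((p - 2) / 2) = (2 - p / 2) - 1"
        by (simp add: field_simps)
      finally show ?thesis
        using measure_pos[of z] by (simp add: powr_diff power2_eq_square)
    qed
    finally have "\<mu> z * c powr (p - 2) / p = (m / h z) powr ((p - 2) / 2) * X * wdeg E w z / 2"
      using measure_pos[of z] deg by (simp add: X_def)
    moreover have "1 < (m / h z) powr ((p - 2) / 2) * X"
      using hX m_pos h_pos[of z] by (simp add: powr_divide field_simps)
    ultimately show ?thesis
      using deg by simp
  qed
  moreover have "c powr p = c\<^sup>2 * c powr (p - 2)"
    using c(1) by (simp add: powr_diff powr_numeral)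
  ultimately have neg: "c\<^sup>2 * wdeg E w z / 2 - \<mu> z * c powr p / p < 0"
    using c(1) mult_strict_left_mono[of "wdeg E w z / 2" "\<mu> z * c powr (p - 2) / p" "c\<^sup>2"]
    by (simp add: algebra_simps)
  have "dirichlet v = (\<Sum>y\<in>nbrs z - {z}. w z y) * c\<^sup>2"
    unfolding v_def dirichlet_fun_upd[OF zero(5)] by (simp add: zero sum_distrib_right)
  also have "\<dots> \<le> wdeg E w z * c\<^sup>2"
    unfolding wdeg_def using finite_nbrs weight_pos
    by (intro mult_right_mono sum_mono2) (auto simp: less_imp_le)
  finally have "dirichlet v \<le> c\<^sup>2 * wdeg E w z"
    by (simp add: mult.commute)
  moreover have "lp_integral v = \<mu> z * c powr p"
    unfolding v_def lp_integral_fun_upd[OF zero(4)] using zero(3) c(1) p_gt_2 by simp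
  ultimately have "energy v < 0"
    using neg by (simp add: energy_def)
  moreover have "mass v = m"
    unfolding v_def mass_fun_upd[OF zero(1)]
    using measure_pos[of z] h_pos[of z] by (simp add: vintegral_eq_0 c(2))
  then have "v \<in> feasible"
    using finite_mass_fun_upd[OF zero(1)] finite_dirichlet_fun_upd[OF zero(5)]
    by (simp add: feasible_def v_def)
  ultimately show ?thesis
    by blast
qed

lemma feasible_imp_H_space:
  assumes "u \<in> feasible"
  shows "u \<in> H_space E w \<mu> h"
proof -
  have u: "finite_mass u" "finite_dirichlet u"
    using assms by (auto simp: feasible_def)
  have "vintegrable \<mu> (\<lambda>x. (u x)\<^sup>2)"
  proof (rule vintegrable_dominated)
    show "vintegrable \<mu> (\<lambda>x. 1 / h\<^sub>0 * (h x * (u x)\<^sup>2))"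
      using u(1) by (rule vintegrable_cmult)
    show "(u x)\<^sup>2 \<le> 1 / h\<^sub>0 * (h x * (u x)\<^sup>2)" for x
      using h0_pos mult_right_mono[OF h0_le[of x], of "(u x)\<^sup>2"] by (simp add: field_simps)
  qed (use measure_pos in auto)
  then have "u \<in> H0_space E w \<mu>"
    using mu_min_pos mu_min_le u(2) by (intro H0_space_if_finite_energy)
  then show ?thesis
    using u by (simp add: H_space_def vintegrable_add)
qed

lemma positive_solution:
  assumes "connected_graph E"
    and "h z < m * (2 / p * (\<mu> z powr (2 - p / 2) / wdeg E w z)) powr (2 / (p - 2))"
  shows "\<exists>lam. \<exists>u \<in> H_space E w \<mu> h.
    (\<forall>x. - laplacian E w \<mu> u x + lam * h x * u x = u x powr (p - 1) \<and> u x > 0) \<and>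
    finite_mass u \<and> mass u = m"
proof -
  obtain u\<^sub>0 where u0: "minimizer u\<^sub>0"
    using minimizer_exists by blast
  define u where "u x = \<bar>u\<^sub>0 x\<bar>" for x
  have u: "minimizer u" and nonneg: "0 \<le> u x" for x
    using minimizer_abs[OF u0] by (simp_all add: u_def[abs_def])
  obtain v where "v \<in> feasible" "energy v < 0"
    using spike_negative[OF assms(2)] by blast
  with u have "energy u < 0"
    unfolding minimizer_def by (meson le_less_trans)
  with u have mass: "mass u = m"
    by (rule negative_minimizer_saturates)
  have feas: "u \<in> feasible"
    using u by (simp add: minimizer_def)
  let ?lam = "(lp_integral u - dirichlet u) / m"
  have eq: "- laplacian E w \<mu> u x + ?lam * h x * u x = u x powr (p - 1)" for x
    using u mass nonneg by (rule Euler_Lagrange)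
  obtain a where a: "u a \<noteq> 0"
  proof (rule ccontr)
    assume "\<not> thesis"
    then have "u x = 0" for x
      using that by blast
    then have "mass u = 0"
      by (intro vintegral_eq_0) simp
    then show False
      using mass m_pos by simp
  qed
  have "laplacian E w \<mu> u x = 0" if "u x = 0" for x
    using eq[of x] that p_gt_2 by simp
  then have "0 < u x" for x
    using assms(1) nonneg a by (intro positive_if_harmonic_at_zeros)
  moreover have "finite_mass u"
    using feas by (simp add: feasible_def)
  ultimately show ?thesis
    using eq mass feasible_imp_H_space[OF feas] by (intro exI[of _ ?lam] bexI[of _ u]) simp_all
qed

end

section \<open>Growth at infinity and finite sublevel sets\<close>

text \<open>Locally finite graphs have finite balls.\<close>

lemma finite_sphere:
  assumes "sym E" "locally_finite_graph E"
  shows "finite {x. (x, a) \<in> E ^^ n}"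
proof (induction n)
  case (Suc n)
  have "{x. (x, a) \<in> E ^^ Suc n} \<subseteq> (\<Union>y\<in>{y. (y, a) \<in> E ^^ n}. E `` {y})"
    using assms(1) by (blast dest: relpow_Suc_D2 symD)
  moreover have "finite (\<Union>y\<in>{y. (y, a) \<in> E ^^ n}. E `` {y})"
    using Suc assms(2) by (simp add: locally_finite_graph_def)
  ultimately show ?case
    by (rule finite_subset)
qed simp

lemma finite_sublevel_if_tends_to_infinity:
  assumes "sym E" "connected_graph E" "locally_finite_graph E"
    and "filterlim (h :: _ \<Rightarrow> real) at_top (filtercomap (\<lambda>x. graph_dist E x a) at_top)"
  shows "finite {x. h x < R}"
proof -
  have "\<forall>\<^sub>F x in filtercomap (\<lambda>x. graph_dist E x a) at_top. R \<le> h x"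
    using assms(4) by (simp add: filterlim_at_top)
  then obtain N where N: "\<And>x. N \<le> graph_dist E x a \<Longrightarrow> R \<le> h x"
    unfolding eventually_filtercomap eventually_at_top_linorder by blast
  have "{x. h x < R} \<subseteq> (\<Union>n<N. {x. (x, a) \<in> E ^^ n})"
  proof
    fix x assume "x \<in> {x. h x < R}"
    then have "graph_dist E x a < N"
      using N by (force simp: not_le[symmetric])
    moreover have "\<exists>n. (x, a) \<in> E ^^ n"
      using assms(2) by (simp add: connected_graph_def rtrancl_power)
    then have "(x, a) \<in> E ^^ graph_dist E x a"
      unfolding graph_dist_def by (rule LeastI_ex)
    ultimately show "x \<in> (\<Union>n<N. {x. (x, a) \<in> E ^^ n})"
      by blast
  qed
  then show ?thesis
    using finite_sphere[OF assms(1,3)] by (auto intro: finite_subset)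
qed

theorem theorem1p3:
  fixes E :: "('a \<times> 'a) set"
    and w :: "'a \<Rightarrow> 'a \<Rightarrow> real"
    and \<mu> h :: "'a \<Rightarrow> real"
    and x\<^sub>0 :: 'a
    and m p \<mu>_min h\<^sub>0 :: real
  assumes "sym E"
    and "connected_graph E"
    and "locally_finite_graph E"
    and "\<And>x y. (x, y) \<in> E \<Longrightarrow> w x y = w y x"
    and "\<And>x y. (x, y) \<in> E \<Longrightarrow> w x y > 0"
    and "\<And>x. \<mu> x > 0"
    and "m > 0"
    and "p > 2"
    and c1: "\<mu>_min > 0" "\<And>x. \<mu> x \<ge> \<mu>_min"
    and c2: "bdd_below (range h)" "(INF x. h x) = h\<^sub>0" "h\<^sub>0 > 0"
            "filterlim h at_top (filtercomap (\<lambda>x. graph_dist E x x\<^sub>0) at_top)"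
    and c3: "h x\<^sub>0 < m * (2 / p * (\<mu> x\<^sub>0 powr (2 - p / 2) / wdeg E w x\<^sub>0)) powr (2 / (p - 2))"
  shows "\<exists>lam. \<exists>u \<in> H_space E w \<mu> h.
           (\<forall>x. - laplacian E w \<mu> u x + lam * h x * u x = u x powr (p - 1) \<and> u x > 0) \<and>
           vintegrable \<mu> (\<lambda>x. h x * (u x)\<^sup>2) \<and>
           vintegral \<mu> (\<lambda>x. h x * (u x)\<^sup>2) = m"
proof -
  have h0_le: "h\<^sub>0 \<le> h x" for x
    using cINF_lower[OF c2(1), of x] c2(2) by simp
  have finite_sublevel: "finite {x. h x < R}" for R
    using assms(1-3) c2(4) by (rule finite_sublevel_if_tends_to_infinity)
  interpret confined_graph E w \<mu> h m p \<mu>_min h\<^sub>0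
    using assms(1,3-8) c1 c2(3) h0_le finite_sublevel by unfold_locales
  show ?thesis
    using assms(2) c3 by (rule positive_solution)
qed

end
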